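(* Let $d\ge1$ and $$\mathscr F=\{(t,h)\in\mathbb R^d\times(0,1/2]^d:\ h_i\le t_i\le1-h_i\text{ for all }i=1,\dots,d\}.$$ For $(t,h),(t',h')\in\mathscr F$ let $B_\infty(t,h)=\prod_{i=1}^d(t_i-h_i,t_i+h_i)$, let $\rho$ be the pseudometric on $\mathscr F$ given by $\rho^2((t,h),(t',h'))=|B_\infty(t,h)\bigtriangleup B_\infty(t',h')|$, and let $\sigma^2(t,h)=|B_\infty(t,h)|=2^d\prod_{i=1}^dh_i$. Then there is a constant $K$ depending only on $d$ such that $$N\big((u\delta)^{1/2},\{(t,h)\in\mathscr F:\sigma^2(t,h)\le\delta\}\big)\le K\,u^{-2d}\,\delta^{-1}\,(\log(e/\delta))^{d-1}\qquad\text{for all }u,\delta\in(0,1].$$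
   Context: $|A|$ denotes the Lebesgue measure of a set $A\subseteq\mathbb R^d$, and $A\bigtriangleup B=(A\cap B^c)\cup(A^c\cap B)$. Packing number: for a pseudometric space $(\mathscr G,\rho)$ and $\epsilon>0$, $N(\epsilon,\mathscr G)$ is the supremum of the number of elements of $\mathscr G'$ over all subsets $\mathscr G'\subseteq\mathscr G$ such that $\rho(a,b)>\epsilon$ for all $a\ne b$ in $\mathscr G'$. *)

theory Defs
  imports "HOL-Analysis.Analysis"
begin

(* card is 0 on infinite sets, so the number of elements is taken in enat. *)
definition ecard :: "'a set \<Rightarrow> enat" where
  "ecard A = (if finite A then enat (card A) else \<infinity>)"

definition packing_number :: "('a \<Rightarrow> 'a \<Rightarrow> real) \<Rightarrow> real \<Rightarrow> 'a set \<Rightarrow> enat" where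
  "packing_number \<rho> \<epsilon> G =
     (SUP G' \<in> {G'. G' \<subseteq> G \<and> (\<forall>a\<in>G'. \<forall>b\<in>G'. a \<noteq> b \<longrightarrow> \<rho> a b > \<epsilon>)}. ecard G')"

(* The dimension d is CARD('n), which is at least 1 since types are nonempty. *)
definition box_params :: "((real ^ 'n) \<times> (real ^ 'n)) set" where
  "box_params = {(t, h). \<forall>i. 0 < h $ i \<and> h $ i \<le> 1 / 2 \<and> h $ i \<le> t $ i \<and> t $ i \<le> 1 - h $ i}"

definition B_inf :: "(real ^ 'n) \<times> (real ^ 'n) \<Rightarrow> (real ^ 'n) set" where
  "B_inf p = {x. \<forall>i. x $ i \<in> {fst p $ i - snd p $ i <..< fst p $ i + snd p $ i}}"

(* All boxes are bounded, so the real-valued measure loses nothing against emeasure;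
   see B_inf_lmeasurable. *)
definition box_dist :: "(real ^ 'n) \<times> (real ^ 'n) \<Rightarrow> (real ^ 'n) \<times> (real ^ 'n) \<Rightarrow> real" where
  "box_dist p q = sqrt (measure lebesgue (sym_diff (B_inf p) (B_inf q)))"

definition sigma_sq :: "(real ^ 'n) \<times> (real ^ 'n) \<Rightarrow> real" where
  "sigma_sq p = measure lebesgue (B_inf p)"

lemma B_inf_eq_box: "B_inf (t, h) = box (t - h) (t + h)"
  by (auto simp: B_inf_def mem_box_cart)

lemma B_inf_lmeasurable: "B_inf p \<in> lmeasurable"
  by (cases p) (simp add: B_inf_eq_box)

lemma sigma_sq_eq:
  fixes t h :: "real ^ 'n"
  assumes "(t, h) \<in> box_params"
  shows "sigma_sq (t, h) = 2 ^ CARD('n) * (\<Prod>i\<in>UNIV. h $ i)"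
proof -
  have ne: "cbox (t - h) (t + h) \<noteq> {}"
    using assms by (auto simp: box_params_def interval_ne_empty_cart intro: less_imp_le)
  have "sigma_sq (t, h) = measure lborel (cbox (t - h) (t + h))"
    by (simp add: sigma_sq_def B_inf_eq_box measure_lborel_box_eq measure_lborel_cbox_eq)
  also have "\<dots> = (\<Prod>i\<in>UNIV. 2 * h $ i)"
    using content_cbox_cart[OF ne] by simp
  finally show ?thesis
    by (simp add: prod.distrib)
qed

lemma box_dist_pseudometric:
  shows "box_dist p p = 0" "0 \<le> box_dist p q" "box_dist p q = box_dist q p"
    "box_dist p r \<le> box_dist p q + box_dist q r"
proof -
  show "box_dist p p = 0" "0 \<le> box_dist p q" "box_dist p q = box_dist q p"
    by (simp_all add: box_dist_def Un_commute)
  let ?S = "\<lambda>p q. sym_diff (B_inf p) (B_inf q)"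
  have m: "?S a b \<in> lmeasurable" for a b :: "(real ^ 'a) \<times> (real ^ 'a)"
    by (intro fmeasurable.Un fmeasurable_Diff fmeasurableD B_inf_lmeasurable)
  have "measure lebesgue (?S p r) \<le> measure lebesgue (?S p q \<union> ?S q r)"
    by (rule measure_mono_fmeasurable)
      (blast, intro fmeasurableD m, intro fmeasurable.Un m)
  also have "\<dots> \<le> measure lebesgue (?S p q) + measure lebesgue (?S q r)"
    using m by (intro measure_Un_le fmeasurableD)
  finally have "box_dist p r \<le> sqrt (measure lebesgue (?S p q) + measure lebesgue (?S q r))"
    by (simp add: box_dist_def)
  also have "\<dots> \<le> box_dist p q + box_dist q r"
    unfolding box_dist_def by (rule sqrt_add_le_add_sqrt) simp_all
  finally show "box_dist p r \<le> box_dist p q + box_dist q r" .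
qed

end

theory Submission
  imports Defs
begin

text \<open>
  At most one element of a packing has measure \<open>\<le> u\<delta>/2\<close>. Sort the others by the dyadic
  levels \<open>k\<^sub>i\<close> of their side lengths; a box with \<open>\<Sum>i. k\<^sub>i = m\<close> has measure about \<open>1 / 2 ^ m\<close>, so
  two such boxes are close as soon as their corners agree up to \<open>\<eta>\<^sub>m / 2 ^ k\<^sub>i\<close> in each coordinate,
  where the relative precision \<open>\<eta>\<^sub>m \<approx> u \<delta> 2 ^ m\<close> may be coarser for smaller boxes.
  There are at most \<open>(m + 1) ^ (d - 1)\<close> level vectors of sum \<open>m\<close>, each with \<open>O(2 ^ m / \<eta>\<^sub>m ^ (2 * d))\<close> grid cells.
  Because \<open>\<eta>\<^sub>m\<close> grows with \<open>m\<close>, the sum over \<open>m\<close> decays geometrically and is dominated by the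
  least admissible level \<open>2 ^ m \<approx> 1 / \<delta>\<close>; a uniform precision \<open>\<eta> \<approx> u\<close> would cost an extra factor \<open>1/u\<close>.
\<close>

section \<open>Volumes of boxes and of their symmetric differences\<close>

text \<open>The truncation at 0 covers empty boxes as well, which occur as intersections of disjoint
  boxes.\<close>

lemma measure_box_cart:
  fixes a b :: "real ^ 'n"
  shows "measure lebesgue (box a b) = (\<Prod>i\<in>UNIV. max 0 (b $ i - a $ i))"
proof (cases "\<forall>i. a $ i \<le> b $ i")
  case True
  then have ne: "cbox a b \<noteq> {}"
    by (auto simp: interval_ne_empty_cart)
  have "measure lebesgue (box a b) = measure lborel (cbox a b)"
    by (simp add: measure_lborel_box_eq measure_lborel_cbox_eq)
  also have "\<dots> = (\<Prod>i\<in>UNIV. max 0 (b $ i - a $ i))"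
    unfolding content_cbox_cart[OF ne] using True by (intro prod.cong) auto
  finally show ?thesis .
next
  case False
  then obtain i where i: "b $ i < a $ i"
    by (auto simp: not_le)
  then have "box a b = {}"
    by (auto simp: interval_eq_empty_cart intro!: exI[of _ i])
  moreover have "(\<Prod>i\<in>UNIV. max 0 (b $ i - a $ i)) = 0"
    using i by (intro prod_zero) (auto intro!: exI[of _ i])
  ultimately show ?thesis
    by simp
qed

lemma box_Int_box_cart:
  fixes a b a' b' :: "real ^ 'n"
  shows "box a b \<inter> box a' b' = box (\<chi> i. max (a $ i) (a' $ i)) (\<chi> i. min (b $ i) (b' $ i))"
  by (auto simp: mem_box_cart)

text \<open>Measuring the displacement of the corners relative to \<open>c i\<close> in each
  coordinate makes the error a multiple of the volume \<open>(\<Prod>i\<in>UNIV. c i)\<close>,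
  however thin the box is in some directions.\<close>

lemma measure_box_Diff_le:
  fixes a b a' b' :: "real ^ 'n"
  assumes c: "\<And>i. 0 < c i" and ab: "\<And>i. a $ i \<le> b $ i" "\<And>i. b $ i - a $ i \<le> c i"
    and close: "\<And>i. \<bar>a $ i - a' $ i\<bar> + \<bar>b $ i - b' $ i\<bar> \<le> \<epsilon> * c i"
  shows "measure lebesgue (box a b - box a' b') \<le> real CARD('n) * \<epsilon> * (\<Prod>i\<in>UNIV. c i)"
proof -
  define z where "z i = (b $ i - a $ i) / c i" for i
  \<comment> \<open>The rescaled side of the intersection; the cut-off at 0 makes the product vanish
    when the boxes are disjoint.\<close>
  define w where "w i = max 0 (min (b $ i) (b' $ i) - max (a $ i) (a' $ i)) / c i" for i
  have z01: "0 \<le> z i" "z i \<le> 1" for i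
    using c[of i] ab(1)[of i] ab(2)[of i] by (auto simp: z_def field_simps)
  have w01: "0 \<le> w i" "w i \<le> z i" for i
    using c[of i] ab(1)[of i] by (auto simp: z_def w_def intro!: divide_right_mono)
  have zw: "\<bar>z i - w i\<bar> \<le> \<epsilon>" for i
  proof -
    have "z i - w i = ((b $ i - a $ i) - max 0 (min (b $ i) (b' $ i) - max (a $ i) (a' $ i))) / c i"
      by (simp add: z_def w_def diff_divide_distrib)
    \<comment> \<open>Passing to the intersection shortens the side by at most
      \<open>\<bar>a $ i - a' $ i\<bar>\<close> on the left and
      \<open>\<bar>b $ i - b' $ i\<bar>\<close> on the right.\<close>
    also have "\<dots> \<le> (\<epsilon> * c i) / c i"
      using close[of i] c[of i] by (intro divide_right_mono) auto
    finally show ?thesis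
      using w01(2)[of i] c[of i] by simp
  qed
  text \<open>After rescaling by \<open>c\<close> all sides are at most 1, where products are 1-Lipschitz in each factor.\<close>
  have "measure lebesgue (box a b - box a' b') = measure lebesgue (box a b - box a b \<inter> box a' b')"
    by (simp add: Diff_Int)
  also have "\<dots> = measure lebesgue (box a b) - measure lebesgue (box a b \<inter> box a' b')"
    by (intro measurable_measure_Diff) (simp_all add: fmeasurable.Int)
  also have "\<dots> = (\<Prod>i\<in>UNIV. z i * c i) - (\<Prod>i\<in>UNIV. w i * c i)"
  proof -
    have "max 0 (b $ i - a $ i) = z i * c i" for i
      using c[of i] ab(1)[of i] by (simp add: z_def)
    moreover have "max 0 (min (b $ i) (b' $ i) - max (a $ i) (a' $ i)) = w i * c i" for i
      using c[of i] by (simp add: w_def)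
    ultimately show ?thesis
      by (simp add: box_Int_box_cart measure_box_cart)
  qed
  also have "\<dots> = ((\<Prod>i\<in>UNIV. z i) - (\<Prod>i\<in>UNIV. w i)) * (\<Prod>i\<in>UNIV. c i)"
    by (simp add: prod.distrib algebra_simps)
  also have "\<dots> \<le> (real CARD('n) * \<epsilon>) * (\<Prod>i\<in>UNIV. c i)"
  proof (rule mult_right_mono)
    have "norm ((\<Prod>i\<in>UNIV. z i) - (\<Prod>i\<in>UNIV. w i)) \<le> (\<Sum>i\<in>UNIV. norm (z i - w i))"
      using z01 w01 by (intro norm_prod_diff) (auto intro: order_trans[OF w01(2)])
    also have "\<dots> \<le> (\<Sum>i\<in>(UNIV::'n set). \<epsilon>)"
      using zw by (intro sum_mono) auto
    finally show "(\<Prod>i\<in>UNIV. z i) - (\<Prod>i\<in>UNIV. w i) \<le> real CARD('n) * \<epsilon>"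
      by simp
    show "0 \<le> (\<Prod>i\<in>UNIV. c i)"
      using c by (intro prod_nonneg) (auto intro: less_imp_le)
  qed
  finally show ?thesis .
qed

lemma measure_box_sym_diff_le:
  fixes a b a' b' :: "real ^ 'n"
  assumes c: "\<And>i. 0 < c i"
    and "\<And>i. a $ i \<le> b $ i" "\<And>i. b $ i - a $ i \<le> c i"
    and "\<And>i. a' $ i \<le> b' $ i" "\<And>i. b' $ i - a' $ i \<le> c i"
    and close: "\<And>i. \<bar>a $ i - a' $ i\<bar> + \<bar>b $ i - b' $ i\<bar> \<le> \<epsilon> * c i"
  shows "measure lebesgue (sym_diff (box a b) (box a' b'))
    \<le> 2 * real CARD('n) * \<epsilon> * (\<Prod>i\<in>UNIV. c i)"
proof -
  have "measure lebesgue (sym_diff (box a b) (box a' b'))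
    \<le> measure lebesgue (box a b - box a' b') + measure lebesgue (box a' b' - box a b)"
    by (intro measure_Un_le) auto
  also have "\<dots> \<le> real CARD('n) * \<epsilon> * (\<Prod>i\<in>UNIV. c i) + real CARD('n) * \<epsilon> * (\<Prod>i\<in>UNIV. c i)"
    using assms by (intro add_mono measure_box_Diff_le) (auto simp: abs_minus_commute)
  finally show ?thesis
    by (simp add: mult_ac)
qed

section \<open>Dyadic levels and the number of level vectors\<close>

text \<open>The least \<open>k\<close> with \<open>(1/2) ^ Suc k < x\<close> works: its minimality
  gives the upper bound, which for \<open>k = 0\<close> is the hypothesis \<open>x \<le> 1\<close>.
  It is applied to the full side lengths \<open>2 * h $ i\<close>.\<close>

lemma ex_dyadic_level:
  fixes x :: real
  assumes "0 < x" "x \<le> 1"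
  shows "\<exists>k::nat. 1 / 2 ^ (k + 1) < x \<and> x \<le> 1 / 2 ^ k"
proof -
  obtain n where n: "(1/2) ^ n < x"
    using real_arch_pow_inv[of x "1/2"] assms(1) by auto
  moreover have "(1/2::real) ^ Suc n \<le> (1/2) ^ n"
    by (rule power_decreasing) auto
  ultimately have "\<exists>k::nat. (1/2) ^ Suc k < x"
    by (meson le_less_trans)
  then obtain k where k: "(1/2) ^ Suc k < x" and least: "\<And>j. j < k \<Longrightarrow> \<not> (1/2) ^ Suc j < x"
    using exists_least_iff[of "\<lambda>k. (1/2) ^ Suc k < x"] by blast
  have "x \<le> (1/2) ^ k"
    using least[of "k - 1"] assms(2) by (cases k) auto
  with k show ?thesis
    by (auto simp: power_one_over)
qed

lemma finite_two_power_less: "finite {m::nat. (2::real) ^ m < b}"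
proof (rule finite_subset)
  show "{m::nat. (2::real) ^ m < b} \<subseteq> {..nat \<lceil>b\<rceil>}"
  proof
    fix m :: nat assume "m \<in> {m. (2::real) ^ m < b}"
    then have "real m < b"
      using less_trans[OF of_nat_less_two_power] by auto
    then show "m \<in> {..nat \<lceil>b\<rceil>}"
      by simp linarith
  qed
qed simp

text \<open>The sum determines the entry at one coordinate \<open>i0\<close> from the others, each
  of which lies in \<open>{..m}\<close>. Saving this one coordinate is what makes the power of the
  logarithm \<open>d - 1\<close> instead of \<open>d\<close>.\<close>

lemma card_sum_eq_le:
  "finite {k :: 'n::finite \<Rightarrow> nat. sum k UNIV = m}"
  "card {k :: 'n::finite \<Rightarrow> nat. sum k UNIV = m} \<le> (m + 1) ^ (CARD('n) - 1)"
proof -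
  let ?S = "{k :: 'n \<Rightarrow> nat. sum k UNIV = m}"
  obtain i0 :: 'n where True by simp
  let ?P = "PiE (UNIV - {i0}) (\<lambda>_. {..m})"
  have inj: "inj_on (\<lambda>k. restrict k (UNIV - {i0})) ?S"
  proof (rule inj_onI)
    fix k l :: "'n \<Rightarrow> nat"
    assume k: "k \<in> ?S" and l: "l \<in> ?S"
      and eq: "restrict k (UNIV - {i0}) = restrict l (UNIV - {i0})"
    have off: "k i = l i" if "i \<noteq> i0" for i
      using fun_cong[OF eq, of i] that by simp
    have "k i0 + sum k (UNIV - {i0}) = l i0 + sum l (UNIV - {i0})"
      using k l by (simp flip: sum.remove)
    moreover have "sum k (UNIV - {i0}) = sum l (UNIV - {i0})"
      using off by (intro sum.cong) auto
    ultimately show "k = l"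
      using off by (metis add_right_cancel ext)
  qed
  have sub: "(\<lambda>k. restrict k (UNIV - {i0})) ` ?S \<subseteq> ?P"
  proof (intro image_subsetI PiE_I)
    fix k i assume "k \<in> ?S" "i \<in> UNIV - {i0}"
    then show "restrict k (UNIV - {i0}) i \<in> {..m}"
      using member_le_sum[of i UNIV k] by auto
  qed auto
  have fin: "finite ?P"
    by (intro finite_PiE) auto
  show "finite ?S"
    using inj sub fin by (rule inj_on_finite)
  have "card ?S \<le> card ?P"
    using inj sub fin by (rule card_inj_on_le)
  then show "card ?S \<le> (m + 1) ^ (CARD('n) - 1)"
    by (simp add: card_PiE)
qed


section \<open>Encoding boxes by grid cells and counting the codes\<close>

text \<open>Sharing a cell of a grid of mesh \<open>s\<close> forces closeness; nonnegativity
  ensures that \<open>nat\<close> does not merge cells.\<close>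

lemma nat_floor_divide_eq_imp_close:
  fixes x y s :: real
  assumes "0 < s" "0 \<le> x" "0 \<le> y" "nat \<lfloor>x / s\<rfloor> = nat \<lfloor>y / s\<rfloor>"
  shows "\<bar>x - y\<bar> \<le> s"
proof -
  have "\<lfloor>x / s\<rfloor> = \<lfloor>y / s\<rfloor>"
    using assms by (simp add: eq_nat_nat_iff)
  then have "\<bar>x / s - y / s\<bar> \<le> 1"
    by linarith
  then have "\<bar>(x - y) / s\<bar> \<le> 1"
    by (simp add: diff_divide_distrib)
  then show ?thesis
    using assms(1) by (simp add: abs_divide)
qed

lemma sigma_sq_eq_prod:
  fixes p :: "(real ^ 'n) \<times> (real ^ 'n)"
  assumes "p \<in> box_params"
  shows "sigma_sq p = (\<Prod>i\<in>UNIV. 2 * snd p $ i)"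
  using sigma_sq_eq[of "fst p" "snd p"] assms by (simp add: prod.distrib)

text \<open>A code made of dyadic levels and grid cells is injective on the packing, so it suffices
  to count codes. \<open>M\<close> contains the level sums compatible with the two bounds on
  \<open>sigma_sq\<close>; each summand bounds the number of level vectors times the number of cells
  for one vector.\<close>

lemma packing_card_le:
  fixes G :: "((real ^ 'n) \<times> (real ^ 'n)) set"
  defines "d \<equiv> CARD('n)"
  assumes u: "0 < u" and \<delta>: "0 < \<delta>"
    and G: "G \<subseteq> {p \<in> box_params. u * \<delta> / 2 < sigma_sq p \<and> sigma_sq p \<le> \<delta>}"
    and sep: "\<And>p q. p \<in> G \<Longrightarrow> q \<in> G \<Longrightarrow> p \<noteq> q \<Longrightarrow> sqrt (u * \<delta>) < box_dist p q"
    and M: "M = {m. 1 / (2 ^ d * \<delta>) \<le> 2 ^ m \<and> 2 ^ m < 2 / (u * \<delta>)}"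
  shows "finite G"
    and "real (card G) \<le> (\<Sum>m\<in>M. real (m + 1) ^ (d - 1) *
           (4 ^ d * 2 ^ m * (6 * real d / (u * \<delta> * 2 ^ m)) ^ (2 * d)))"
proof -
  have d: "0 < d"
    by (simp add: d_def)
  \<comment> \<open>The membership condition stands under the existential so that choice yields a
    total function \<open>\<kappa>\<close>.\<close>
  have "\<forall>p i. \<exists>k::nat. p \<in> box_params \<longrightarrow>
      1 / 2 ^ (k + 1) < 2 * snd (p :: (real ^ 'n) \<times> (real ^ 'n)) $ i \<and> 2 * snd p $ i \<le> 1 / 2 ^ k"
  proof (intro allI)
    fix p :: "(real ^ 'n) \<times> (real ^ 'n)" and i
    show "\<exists>k::nat. p \<in> box_params \<longrightarrow>
      1 / 2 ^ (k + 1) < 2 * snd p $ i \<and> 2 * snd p $ i \<le> 1 / 2 ^ k"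
    proof (cases "p \<in> box_params")
      case True
      then have "0 < 2 * snd p $ i" "2 * snd p $ i \<le> 1"
        by (auto simp: box_params_def dest!: spec[of _ i])
      then show ?thesis
        using ex_dyadic_level by blast
    qed auto
  qed
  then obtain \<kappa> :: "(real ^ 'n) \<times> (real ^ 'n) \<Rightarrow> 'n \<Rightarrow> nat" where
    \<kappa>: "\<And>p i. p \<in> box_params \<Longrightarrow> 1 / 2 ^ (\<kappa> p i + 1) < 2 * snd p $ i"
       "\<And>p i. p \<in> box_params \<Longrightarrow> 2 * snd p $ i \<le> 1 / 2 ^ \<kappa> p i"
    by metis
  define \<mu> where "\<mu> p = sum (\<kappa> p) UNIV" for p
  \<comment> \<open>The constant \<open>6 * real d\<close> is the factor \<open>2 * real d\<close>
    of \<open>measure_box_sym_diff_le\<close> times the 3 meshes by which the two endpoints of a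
    side can move in total. It makes the distance bound for equal codes exactly
    \<open>u * \<delta>\<close>.\<close>
  define \<eta> where "\<eta> m = u * \<delta> * 2 ^ m / (6 * real d)" for m :: nat
  \<comment> \<open>The cells locate the left endpoint and the side length. The mesh depends on the
    levels only, so equal codes refer to the same grid.\<close>
  define code where "code p =
      (\<kappa> p, \<lambda>i. (nat \<lfloor>(fst p $ i - snd p $ i) / (\<eta> (\<mu> p) / 2 ^ \<kappa> p i)\<rfloor>,
                 nat \<lfloor>2 * snd p $ i / (\<eta> (\<mu> p) / 2 ^ \<kappa> p i)\<rfloor>))"
    for p :: "(real ^ 'n) \<times> (real ^ 'n)"
  \<comment> \<open>The left endpoint lies in [0,1] and the side length is at most
    \<open>1 / 2 ^ k i\<close>; division by the mesh \<open>\<eta> m / 2 ^ k i\<close> gives the two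
    ranges.\<close>
  define C where "C m k = PiE (UNIV :: 'n set)
      (\<lambda>i. {..nat \<lfloor>2 ^ k i / \<eta> m\<rfloor>} \<times> {..nat \<lfloor>1 / \<eta> m\<rfloor>})" for m :: nat and k :: "'n \<Rightarrow> nat"
  define S where "S m = {k :: 'n \<Rightarrow> nat. sum k UNIV = m}" for m
  define T where "T = (\<Union>m\<in>M. Sigma (S m) (C m))"

  have \<eta>: "0 < \<eta> m" for m
    using u \<delta> d by (simp add: \<eta>_def)
  \<comment> \<open>With this the cell counts \<open>1 + nat \<lfloor>x\<rfloor>\<close> below have
    \<open>1 \<le> x\<close> and are at most \<open>2 * x\<close>; the two such factors per
    coordinate produce \<open>4 ^ d\<close>.\<close>
  have \<eta>1: "\<eta> m \<le> 1" if "m \<in> M" for m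
  proof -
    have "u * \<delta> * 2 ^ m \<le> 2"
      using that u \<delta> by (auto simp: M field_simps)
    also have "2 \<le> 6 * real d"
      using d by simp
    finally show ?thesis
      using d by (simp add: \<eta>_def)
  qed
  have finM: "finite M"
    unfolding M by (rule finite_subset[OF _ finite_two_power_less]) auto
  have prod_level: "(\<Prod>i\<in>UNIV. 1 / 2 ^ \<kappa> p i) = 1 / (2::real) ^ \<mu> p" for p
    by (simp add: \<mu>_def prod_dividef power_sum)
  \<comment> \<open>The levels pin the volume down up to the factor \<open>2 ^ d\<close>:
    \<open>sigma_sq p\<close> lies between \<open>1 / 2 ^ (\<mu> p + d)\<close> and
    \<open>1 / 2 ^ \<mu> p\<close>.\<close>
  have \<mu>M: "\<mu> p \<in> M" if p: "p \<in> G" for p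
  proof -
    have bp: "p \<in> box_params" and lo: "u * \<delta> / 2 < sigma_sq p" and hi: "sigma_sq p \<le> \<delta>"
      using G p by auto
    have pos: "0 < snd p $ i" for i
      using bp by (auto simp: box_params_def)
    have "sigma_sq p \<le> (\<Prod>i\<in>UNIV. 1 / 2 ^ \<kappa> p i)"
      unfolding sigma_sq_eq_prod[OF bp] using \<kappa>(2)[OF bp] pos
      by (intro prod_mono) (auto intro: less_imp_le)
    with lo have 1: "u * \<delta> / 2 < 1 / 2 ^ \<mu> p"
      by (simp add: prod_level)
    have "(\<Prod>i\<in>UNIV. 1 / 2 ^ \<kappa> p i * (1/2)) \<le> sigma_sq p"
      unfolding sigma_sq_eq_prod[OF bp] using \<kappa>(1)[OF bp]
      by (intro prod_mono) (auto intro: less_imp_le simp: mult_ac)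
    then have "1 / 2 ^ \<mu> p * (1/2) ^ d \<le> \<delta>"
      using hi unfolding prod.distrib prod_level by (simp add: d_def)
    with 1 show ?thesis
      using u \<delta> by (simp add: M field_simps power_one_over)
  qed
  have inj: "inj_on code G"
  proof (rule inj_onI)
    fix p q assume p: "p \<in> G" and q: "q \<in> G" and eq: "code p = code q"
    have bp: "p \<in> box_params" and bq: "q \<in> box_params"
      using G p q by auto
    have \<kappa>eq: "\<kappa> p = \<kappa> q"
      using eq by (simp add: code_def)
    then have \<mu>eq: "\<mu> p = \<mu> q"
      by (simp add: \<mu>_def)
    define s where "s i = \<eta> (\<mu> q) / 2 ^ \<kappa> q i" for i
    have s: "0 < s i" for i
      using \<eta> by (simp add: s_def)
    have pos: "0 < snd p $ i" "0 < snd q $ i" "0 \<le> fst p $ i - snd p $ i"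
        "0 \<le> fst q $ i - snd q $ i" for i
      using bp bq by (auto simp: box_params_def)
    have snd_eq: "snd (code p) i = snd (code q) i" for i
      by (simp add: eq)
    have close: "\<bar>(fst p $ i - snd p $ i) - (fst q $ i - snd q $ i)\<bar> \<le> s i"
        "\<bar>2 * snd p $ i - 2 * snd q $ i\<bar> \<le> s i" for i
      using snd_eq[of i] s[of i] pos[of i]
      by (auto intro!: nat_floor_divide_eq_imp_close simp: code_def \<kappa>eq \<mu>eq s_def)
    have "measure lebesgue (sym_diff (B_inf p) (B_inf q)) \<le>
        2 * real CARD('n) * (3 * \<eta> (\<mu> q)) * (\<Prod>i\<in>UNIV. 1 / 2 ^ \<kappa> q i)"
    proof -
      have B: "B_inf r = box (fst r - snd r) (fst r + snd r)" for r :: "(real ^ 'n) \<times> (real ^ 'n)"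
        using B_inf_eq_box[of "fst r" "snd r"] by simp
      show ?thesis
        unfolding B
      proof (rule measure_box_sym_diff_le, goal_cases)
        case (2 i)
        then show ?case using pos(1)[of i] by simp
      next
        case (3 i)
        then show ?case using \<kappa>(2)[OF bp, of i] by (simp add: \<kappa>eq)
      next
        case (4 i)
        then show ?case using pos(2)[of i] by simp
      next
        case (5 i)
        then show ?case using \<kappa>(2)[OF bq, of i] by simp
      next
        case (6 i)
        \<comment> \<open>The left endpoint moves by at most \<open>s i\<close>; the right one is
          left endpoint plus side length and moves by at most \<open>2 * s i\<close>.\<close>
        have "\<bar>(fst p - snd p) $ i - (fst q - snd q) $ i\<bar> +
            \<bar>(fst p + snd p) $ i - (fst q + snd q) $ i\<bar> \<le> 3 * s i"
          using close[of i] by simp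
        then show ?case by (simp add: s_def)
      qed simp
    qed
    also have "\<dots> = u * \<delta>"
      using d unfolding prod_level \<eta>_def d_def by simp
    finally have "box_dist p q \<le> sqrt (u * \<delta>)"
      unfolding box_dist_def by (rule real_sqrt_le_mono)
    then show "p = q"
      using sep[OF p q] by force
  qed
  have sub: "code ` G \<subseteq> T"
  proof (rule image_subsetI)
    fix p assume p: "p \<in> G"
    then have bp: "p \<in> box_params"
      using G by auto
    have "nat \<lfloor>(fst p $ i - snd p $ i) / (\<eta> (\<mu> p) / 2 ^ \<kappa> p i)\<rfloor> \<le> nat \<lfloor>2 ^ \<kappa> p i / \<eta> (\<mu> p)\<rfloor>" for i
    proof (intro nat_mono floor_mono)
      have "0 < snd p $ i" "fst p $ i \<le> 1 - snd p $ i"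
        using bp by (auto simp: box_params_def)
      then have "(fst p $ i - snd p $ i) * 2 ^ \<kappa> p i \<le> 1 * 2 ^ \<kappa> p i"
        by (intro mult_right_mono) auto
      then show "(fst p $ i - snd p $ i) / (\<eta> (\<mu> p) / 2 ^ \<kappa> p i) \<le> 2 ^ \<kappa> p i / \<eta> (\<mu> p)"
        using \<eta>[of "\<mu> p"] by (simp add: divide_right_mono)
    qed
    moreover have "nat \<lfloor>2 * snd p $ i / (\<eta> (\<mu> p) / 2 ^ \<kappa> p i)\<rfloor> \<le> nat \<lfloor>1 / \<eta> (\<mu> p)\<rfloor>" for i
    proof (intro nat_mono floor_mono)
      have "2 * snd p $ i * 2 ^ \<kappa> p i \<le> 1"
        using \<kappa>(2)[OF bp, of i] by (simp add: field_simps)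
      then show "2 * snd p $ i / (\<eta> (\<mu> p) / 2 ^ \<kappa> p i) \<le> 1 / \<eta> (\<mu> p)"
        using \<eta>[of "\<mu> p"] by (simp add: divide_right_mono)
    qed
    ultimately have "code p \<in> Sigma (S (\<mu> p)) (C (\<mu> p))"
      by (simp add: code_def S_def C_def \<mu>_def PiE_iff)
    then show "code p \<in> T"
      using \<mu>M[OF p] by (auto simp: T_def)
  qed
  have finS: "finite (S m)" for m
    unfolding S_def by (rule card_sum_eq_le)
  have finC: "finite (C m k)" for m k
    unfolding C_def by (intro finite_PiE) auto
  have finT: "finite T"
    unfolding T_def using finM finS finC by (intro finite_UN_I finite_SigmaI)
  show "finite G"
    using inj sub finT by (rule inj_on_finite)
  have cardC: "real (card (C m k)) \<le> 4 ^ d * 2 ^ m * (6 * real d / (u * \<delta> * 2 ^ m)) ^ (2 * d)"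
    if m: "m \<in> M" and k: "k \<in> S m" for m k
  proof -
    have half: "1 + real (nat \<lfloor>x\<rfloor>) \<le> 2 * x" if "1 \<le> x" for x :: real
      using that by linarith
    have "real (card (C m k)) =
        (\<Prod>i\<in>UNIV. (1 + real (nat \<lfloor>2 ^ k i / \<eta> m\<rfloor>)) * (1 + real (nat \<lfloor>1 / \<eta> m\<rfloor>)))"
      by (simp add: C_def card_PiE card_cartesian_product algebra_simps)
    also have "\<dots> \<le> (\<Prod>i\<in>UNIV. (2 * (2 ^ k i / \<eta> m)) * (2 * (1 / \<eta> m)))"
    proof (intro prod_mono conjI mult_mono half)
      fix i
      show "1 \<le> 2 ^ k i / \<eta> m"
        using order_trans[OF \<eta>1[OF m], of "2 ^ k i"] \<eta>[of m] by (simp add: le_divide_eq)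
    qed (use \<eta>1[OF m] \<eta>[of m] in auto)
    also have "\<dots> = (\<Prod>i\<in>UNIV. 4 * (1 / \<eta> m) ^ 2 * 2 ^ k i)"
      by (intro prod.cong) (auto simp: power2_eq_square)
    also have "\<dots> = 4 ^ d * 2 ^ m * (1 / \<eta> m) ^ (2 * d)"
      using k by (simp add: prod.distrib d_def S_def power_mult flip: power_sum)
    also have "1 / \<eta> m = 6 * real d / (u * \<delta> * 2 ^ m)"
      by (simp add: \<eta>_def)
    finally show ?thesis .
  qed
  have "card G \<le> card T"
    using inj sub finT by (rule card_inj_on_le)
  also have "\<dots> \<le> (\<Sum>m\<in>M. card (Sigma (S m) (C m)))"
    unfolding T_def by (rule card_UN_le[OF finM])
  finally have "real (card G) \<le> (\<Sum>m\<in>M. real (card (Sigma (S m) (C m))))"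
    by (simp flip: of_nat_sum)
  also have "\<dots> \<le> (\<Sum>m\<in>M. real (m + 1) ^ (d - 1) *
           (4 ^ d * 2 ^ m * (6 * real d / (u * \<delta> * 2 ^ m)) ^ (2 * d)))"
  proof (rule sum_mono)
    fix m assume m: "m \<in> M"
    let ?c = "4 ^ d * 2 ^ m * (6 * real d / (u * \<delta> * 2 ^ m)) ^ (2 * d)"
    have "real (card (Sigma (S m) (C m))) = (\<Sum>k\<in>S m. real (card (C m k)))"
      using finS finC by (simp add: card_SigmaI)
    also have "\<dots> \<le> real (card (S m)) * ?c"
      using cardC[OF m] by (rule sum_bounded_above)
    also have "\<dots> \<le> real (m + 1) ^ (d - 1) * ?c"
    proof (rule mult_right_mono)
      have "real (card (S m)) \<le> real ((m + 1) ^ (d - 1))"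
        unfolding S_def d_def of_nat_le_iff by (rule card_sum_eq_le)
      then show "real (card (S m)) \<le> real (m + 1) ^ (d - 1)"
        by simp
    qed (use u \<delta> in simp)
    finally show "real (card (Sigma (S m) (C m))) \<le> real (m + 1) ^ (d - 1) * ?c" .
  qed
  finally show "real (card G) \<le> (\<Sum>m\<in>M. real (m + 1) ^ (d - 1) *
           (4 ^ d * 2 ^ m * (6 * real d / (u * \<delta> * 2 ^ m)) ^ (2 * d)))" .
qed

section \<open>Summation over the levels\<close>

text \<open>All \<open>m\<close> in \<open>M\<close> are at least the least \<open>n\<close> with
  \<open>1 / (2 ^ d * \<delta>) \<le> 2 ^ n\<close>. From there on the terms are dominated by a
  geometric series of ratio \<open>1/2\<close>, and \<open>n + 1\<close> is at most twice the
  logarithm.\<close>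

lemma level_sum_le:
  fixes \<delta> :: real
  assumes d: "0 < d" and \<delta>: "0 < \<delta>" "\<delta> \<le> 1"
    and M: "finite M" "\<And>m. m \<in> M \<Longrightarrow> 1 / (2 ^ d * \<delta>) \<le> 2 ^ m"
  shows "(\<Sum>m\<in>M. real (m + 1) ^ (d - 1) / (2 ^ m) ^ (2 * d - 1))
    \<le> 2 * 2 ^ (d - 1) * (2 ^ d * \<delta>) ^ (2 * d - 1) * ln (exp 1 / \<delta>) ^ (d - 1)"
proof -
  define x where "x = 1 / (2 ^ d * \<delta>)"
  have x: "0 < x"
    using \<delta> by (simp add: x_def)
  obtain N where "x \<le> 2 ^ N"
    using real_arch_pow[of 2 x] by (auto intro: less_imp_le)
  then obtain n where n: "x \<le> 2 ^ n" and least: "\<And>m. m < n \<Longrightarrow> \<not> x \<le> 2 ^ m"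
    using exists_least_iff[of "\<lambda>m. x \<le> 2 ^ m"] by blast
  have L: "ln (exp 1 / \<delta>) = 1 + ln (1 / \<delta>)"
    using \<delta> by (simp add: ln_div)
  have L0: "0 \<le> ln (1 / \<delta>)"
    using \<delta> by simp
  \<comment> \<open>For positive \<open>n\<close>, minimality gives
    \<open>2 ^ n \<le> 1 / \<delta>\<close>, and \<open>ln 2\<close> is at least \<open>1/2\<close>;
    the summand 1 in the logarithm covers \<open>n + 1\<close> and the case
    \<open>n = 0\<close>.\<close>
  have nL: "real (n + 1) \<le> 2 * ln (exp 1 / \<delta>)"
  proof (cases n)
    case 0
    then show ?thesis
      using L L0 by simp
  next
    case (Suc k)
    have "2 ^ k < x"
      using least[of k] Suc by simp
    also have "x \<le> 1 / (2 * \<delta>)"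
      unfolding x_def using \<delta> self_le_power[of "2::real" d] d by (intro divide_left_mono) auto
    finally have "2 ^ n \<le> 1 / \<delta>"
      using \<delta> Suc by (simp add: field_simps)
    then have "ln (2 ^ n) \<le> ln (1 / \<delta>)"
      using \<delta> by (subst ln_le_cancel_iff) auto
    then have "real n * ln 2 \<le> ln (1 / \<delta>)"
      by (simp add: ln_realpow)
    moreover have "real n * (1/2) \<le> real n * ln 2"
      using ln2_ge_two_thirds by (intro mult_left_mono) auto
    ultimately show ?thesis
      unfolding L by simp
  qed
  have "(\<Sum>m\<in>M. real (m + 1) ^ (d - 1) / (2 ^ m) ^ (2 * d - 1))
      \<le> (\<Sum>m\<in>M. real (n + 1) ^ (d - 1) / x ^ (2 * d - 1) * (1/2) ^ (m - n))"
  proof (rule sum_mono)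
    fix m assume m: "m \<in> M"
    have "n \<le> m"
      using least[of m] M(2)[OF m] by (auto simp: x_def not_less[symmetric])
    then obtain j where j: "m = n + j"
      using le_Suc_ex by blast
    have "real (m + 1) \<le> real (n + 1) * real (j + 1)"
      by (simp add: j algebra_simps)
    also have "\<dots> \<le> real (n + 1) * 2 ^ j"
    proof (intro mult_left_mono)
      have "j + 1 \<le> 2 ^ j"
        by (metis Suc_eq_plus1 Suc_leI less_exp)
      then have "real (j + 1) \<le> real (2 ^ j)"
        by (rule of_nat_mono)
      then show "real (j + 1) \<le> 2 ^ j"
        by simp
    qed simp
    finally have "real (m + 1) ^ (d - 1) \<le> (real (n + 1) * 2 ^ j) ^ (d - 1)"
      by (intro power_mono) auto
    moreover have "(x * 2 ^ j) ^ (2 * d - 1) \<le> (2 ^ m) ^ (2 * d - 1)"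
      using n x by (intro power_mono) (auto simp: j power_add)
    ultimately have "real (m + 1) ^ (d - 1) / (2 ^ m) ^ (2 * d - 1)
        \<le> (real (n + 1) * 2 ^ j) ^ (d - 1) / (x * 2 ^ j) ^ (2 * d - 1)"
      using x by (intro frac_le) auto
    also have "\<dots> = real (n + 1) ^ (d - 1) / x ^ (2 * d - 1) * ((2 ^ j) ^ (d - 1) / (2 ^ j) ^ (2 * d - 1))"
      by (simp add: power_mult_distrib)
    also have "\<dots> \<le> real (n + 1) ^ (d - 1) / x ^ (2 * d - 1) * (1/2) ^ j"
    proof (intro mult_left_mono)
      \<comment> \<open>The growth of the number of level vectors uses up \<open>d - 1\<close> of
        the powers of \<open>2 ^ j\<close> in the denominator; of the remaining \<open>d\<close>,
        one suffices for geometric decay.\<close>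
      have "2 * d - 1 = (d - 1) + d"
        using d by simp
      then have "(2 ^ j) ^ (d - 1) / (2 ^ j) ^ (2 * d - 1) = 1 / ((2::real) ^ j) ^ d"
        by (simp add: power_add)
      also have "\<dots> \<le> 1 / 2 ^ j"
        using self_le_power[of "(2::real) ^ j" d] d by (intro divide_left_mono) auto
      finally show "(2 ^ j) ^ (d - 1) / (2 ^ j) ^ (2 * d - 1) \<le> (1/2 :: real) ^ j"
        by (simp add: power_one_over)
    qed (use x in auto)
    finally show "real (m + 1) ^ (d - 1) / (2 ^ m) ^ (2 * d - 1)
        \<le> real (n + 1) ^ (d - 1) / x ^ (2 * d - 1) * (1/2) ^ (m - n)"
      by (simp add: j)
  qed
  also have "\<dots> = real (n + 1) ^ (d - 1) / x ^ (2 * d - 1) * (\<Sum>m\<in>M. (1/2) ^ (m - n))"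
    by (simp add: sum_distrib_left)
  also have "\<dots> \<le> (2 * ln (exp 1 / \<delta>)) ^ (d - 1) / x ^ (2 * d - 1) * 2"
  proof (intro mult_mono divide_right_mono power_mono nL)
    have "inj_on (\<lambda>m. m - n) M"
    proof (rule inj_onI)
      fix a b assume "a \<in> M" "b \<in> M" "a - n = b - n"
      moreover have "n \<le> m" if "m \<in> M" for m
        using least[of m] M(2)[OF that] by (auto simp: x_def not_less[symmetric])
      ultimately show "a = b"
        by (metis eq_diff_iff)
    qed
    then have "(\<Sum>m\<in>M. (1/2 :: real) ^ (m - n)) = (\<Sum>j\<in>(\<lambda>m. m - n) ` M. (1/2) ^ j)"
      by (simp add: sum.reindex)
    also have "\<dots> \<le> (\<Sum>j. (1/2) ^ j)"
      using M(1) by (intro sum_le_suminf summable_geometric) auto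
    also have "\<dots> = 2"
      by (subst suminf_geometric) auto
    finally show "(\<Sum>m\<in>M. (1/2 :: real) ^ (m - n)) \<le> 2" .
  qed (use x L L0 in \<open>auto intro!: sum_nonneg\<close>)
  also have "\<dots> = 2 * 2 ^ (d - 1) * (2 ^ d * \<delta>) ^ (2 * d - 1) * ln (exp 1 / \<delta>) ^ (d - 1)"
    by (simp add: x_def power_mult_distrib power_one_over)
  finally show ?thesis .
qed

section \<open>Boxes of small volume and the final estimate\<close>

text \<open>The symmetric difference is no larger than the two volumes together. Hence a packing
  contains at most one box below the volume threshold.\<close>

lemma box_dist_le_if_sigma_sq_le:
  assumes "sigma_sq p \<le> \<epsilon> / 2" "sigma_sq q \<le> \<epsilon> / 2"
  shows "box_dist p q \<le> sqrt \<epsilon>"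
proof -
  have meas: "B_inf p \<in> sets lebesgue" "B_inf q \<in> sets lebesgue"
    by (intro fmeasurableD B_inf_lmeasurable)+
  have "measure lebesgue (sym_diff (B_inf p) (B_inf q))
      \<le> measure lebesgue (B_inf p - B_inf q) + measure lebesgue (B_inf q - B_inf p)"
    using meas by (intro measure_Un_le) auto
  also have "\<dots> \<le> measure lebesgue (B_inf p) + measure lebesgue (B_inf q)"
    using meas by (intro add_mono measure_mono_fmeasurable B_inf_lmeasurable) auto
  also have "\<dots> \<le> \<epsilon>"
    using assms by (simp add: sigma_sq_def)
  finally show ?thesis
    unfolding box_dist_def by (rule real_sqrt_le_mono)
qed

theorem lemma2p1:
  shows "\<exists>K::real. \<forall>u \<delta>. 0 < u \<and> u \<le> 1 \<and> 0 < \<delta> \<and> \<delta> \<le> 1 \<longrightarrow>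
    ereal_of_enat (packing_number box_dist (sqrt (u * \<delta>))
        {p \<in> (box_params :: ((real ^ 'n) \<times> (real ^ 'n)) set). sigma_sq p \<le> \<delta>})
      \<le> ereal (K * u powi (- 2 * int CARD('n)) * inverse \<delta> * ln (exp 1 / \<delta>) ^ (CARD('n) - 1))"
proof -
  define d where "d = CARD('n)"
  have d: "0 < d"
    by (simp add: d_def)
  \<comment> \<open>\<open>c\<close> gathers the constants of the cell count and \<open>c'\<close>
    those of the sum over levels; the extra 1 in \<open>c * c' + 1\<close> pays for the single small
    box.\<close>
  define c where "c = 4 ^ d * (6 * real d) ^ (2 * d)"
  define c' where "c' = (2::real) * 2 ^ (d - 1) * (2 ^ d) ^ (2 * d - 1)"
  have main: "ereal_of_enat (packing_number box_dist (sqrt (u * \<delta>))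
        {p \<in> (box_params :: ((real ^ 'n) \<times> (real ^ 'n)) set). sigma_sq p \<le> \<delta>})
      \<le> ereal ((c * c' + 1) * u powi (- 2 * int d) * inverse \<delta> * ln (exp 1 / \<delta>) ^ (d - 1))"
    if u: "0 < u" "u \<le> 1" and \<delta>: "0 < \<delta>" "\<delta> \<le> 1" for u \<delta>
  proof -
    define L where "L = ln (exp 1 / \<delta>) ^ (d - 1)"
    define b where "b = (c * c' + 1) * u powi (- 2 * int d) * inverse \<delta> * L"
    have uu: "u powi (- 2 * int d) = 1 / u ^ (2 * d)"
      using power_int_minus[of u "int (2 * d)"] unfolding power_int_of_nat
      by (simp add: divide_inverse)
    have ln1: "1 \<le> ln (exp 1 / \<delta>)"
      using \<delta> by (simp add: ln_div)
    then have "1 \<le> L"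
      unfolding L_def by (rule one_le_power)
    moreover have "1 \<le> 1 / u ^ (2 * d)"
      using u by (simp add: power_le_one)
    moreover have "1 \<le> inverse \<delta>"
      using \<delta> by (simp add: one_le_inverse)
    \<comment> \<open>Since this product is at least 1, the small box can be absorbed into the
      constant.\<close>
    ultimately have one: "1 \<le> u powi (- 2 * int d) * inverse \<delta> * L"
      unfolding uu by (intro mult_ge1_I) auto
    \<comment> \<open>The supremum is taken in \<open>enat\<close>, so the real bound is first
      rounded down; this loses nothing for integer cardinalities.\<close>
    have "ecard G \<le> enat (nat \<lfloor>b\<rfloor>)"
      if sub: "G \<subseteq> {p \<in> (box_params :: ((real ^ 'n) \<times> (real ^ 'n)) set). sigma_sq p \<le> \<delta>}"
        and sep: "\<And>p q. p \<in> G \<Longrightarrow> q \<in> G \<Longrightarrow> p \<noteq> q \<Longrightarrow> sqrt (u * \<delta>) < box_dist p q" for G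
    proof -
      define G0 where "G0 = {p \<in> G. sigma_sq p \<le> u * \<delta> / 2}"
      define G1 where "G1 = {p \<in> G. u * \<delta> / 2 < sigma_sq p}"
      define M where "M = {m. 1 / (2 ^ CARD('n) * \<delta>) \<le> 2 ^ m \<and> 2 ^ m < 2 / (u * \<delta>)}"
      have "p = q" if "p \<in> G0" "q \<in> G0" for p q
        using that sep[of p q] box_dist_le_if_sigma_sq_le[of p "u * \<delta>" q] by (force simp: G0_def)
      then obtain r where "G0 \<subseteq> {r}"
        by blast
      then have G0: "finite G0" "card G0 \<le> 1"
        using finite_subset card_mono[of "{r}" G0] by auto
      have sub1: "G1 \<subseteq> {p \<in> box_params. u * \<delta> / 2 < sigma_sq p \<and> sigma_sq p \<le> \<delta>}"
        using sub by (auto simp: G1_def)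
      have sep1: "sqrt (u * \<delta>) < box_dist p q" if "p \<in> G1" "q \<in> G1" "p \<noteq> q" for p q
        using that by (intro sep) (auto simp: G1_def)
      note G1 = packing_card_le[OF u(1) \<delta>(1) sub1 sep1 M_def, folded d_def]
      have finM: "finite M"
        unfolding M_def by (rule finite_subset[OF _ finite_two_power_less]) auto
      have "real (card G1) \<le> (\<Sum>m\<in>M. real (m + 1) ^ (d - 1) *
           (4 ^ d * 2 ^ m * (6 * real d / (u * \<delta> * 2 ^ m)) ^ (2 * d)))"
        by (rule G1(2))
      also have "\<dots> = (\<Sum>m\<in>M. c / (u * \<delta>) ^ (2 * d) * (real (m + 1) ^ (d - 1) / (2 ^ m) ^ (2 * d - 1)))"
      proof (rule sum.cong[OF refl])
        fix m
        \<comment> \<open>The factor \<open>2 ^ m\<close> from the number of positions cancels one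
          of the \<open>2 * d\<close> powers.\<close>
        have "((2::real) ^ m) ^ (2 * d) = 2 ^ m * (2 ^ m) ^ (2 * d - 1)"
          using d by (simp flip: power_Suc)
        then show "real (m + 1) ^ (d - 1) * (4 ^ d * 2 ^ m * (6 * real d / (u * \<delta> * 2 ^ m)) ^ (2 * d))
          = c / (u * \<delta>) ^ (2 * d) * (real (m + 1) ^ (d - 1) / (2 ^ m) ^ (2 * d - 1))"
          using u \<delta> by (simp add: c_def power_divide power_mult_distrib mult_ac)
      qed
      also have "\<dots> = c / (u * \<delta>) ^ (2 * d) * (\<Sum>m\<in>M. real (m + 1) ^ (d - 1) / (2 ^ m) ^ (2 * d - 1))"
        by (simp add: sum_distrib_left)
      also have "\<dots> \<le> c / (u * \<delta>) ^ (2 * d) * (2 * 2 ^ (d - 1) * (2 ^ d * \<delta>) ^ (2 * d - 1) * L)"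
        unfolding L_def using d \<delta> finM u
        by (intro mult_left_mono level_sum_le) (auto simp: M_def d_def c_def)
      also have "\<dots> = c * c' * (u powi (- 2 * int d) * inverse \<delta> * L)"
      proof -
        \<comment> \<open>The level sum contributes \<open>\<delta> ^ (2 * d - 1)\<close>, so only
          one power of \<open>inverse \<delta>\<close> survives, while all \<open>2 * d\<close>
          powers of \<open>1 / u\<close> remain.\<close>
        have "\<delta> ^ (2 * d) = \<delta> * \<delta> ^ (2 * d - 1)"
          using d by (simp flip: power_Suc)
        then show ?thesis
          unfolding uu using u \<delta> by (simp add: c'_def power_mult_distrib divide_inverse)
      qed
      finally have "real (card G0 + card G1) \<le> b"
        using G0(2) one by (simp add: b_def algebra_simps)
      moreover have "G = G0 \<union> G1"
        by (auto simp: G0_def G1_def)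
      ultimately show ?thesis
        using G0(1) G1(1) card_Un_le[of G0 G1] by (simp add: ecard_def le_nat_floor)
    qed
    then have "packing_number box_dist (sqrt (u * \<delta>))
        {p \<in> (box_params :: ((real ^ 'n) \<times> (real ^ 'n)) set). sigma_sq p \<le> \<delta>} \<le> enat (nat \<lfloor>b\<rfloor>)"
      unfolding packing_number_def by (intro SUP_least) auto
    then have "ereal_of_enat (packing_number box_dist (sqrt (u * \<delta>))
        {p \<in> (box_params :: ((real ^ 'n) \<times> (real ^ 'n)) set). sigma_sq p \<le> \<delta>})
        \<le> ereal_of_enat (enat (nat \<lfloor>b\<rfloor>))"
      by (simp only: ereal_of_enat_le_iff)
    also have "0 \<le> b"
      using one unfolding b_def mult.assoc by (auto intro!: mult_nonneg_nonneg simp: c_def c'_def)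
    then have "ereal_of_enat (enat (nat \<lfloor>b\<rfloor>)) \<le> ereal b"
      by simp
    finally show ?thesis
      by (simp add: b_def L_def)
  qed
  show ?thesis
    using main unfolding d_def by blast
qed

end
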